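(* Consider the finite-horizon risk-averse optimal stopping problem (a Markov decision process) with state space $\mathcal X\subseteq\mathbb R^n$ equipped with the componentwise partial order $\preceq_c$, transition kernels $Q_t$, stopping costs $s_t$, continuation costs $c_t$ and coherent one-step risk measures $\rho_t$. Suppose that $\rho_t$ is distribution-invariant for every $t$, and that (1) for each $t=0,\dots,T-1$, $Q_t(\cdot\mid x)$ is stochastically increasing in $x\in\mathcal X$; (2) $c_t(x)$ (for $t=0,\dots,T-1$) and $s_t(x)$ (for $t=0,\dots,T$) are decreasing in $x\in\mathcal X$; (3) for every $t$ and $x\in\mathcal X$, the risk envelope $\mathcal A_t(Q_t(\cdot\mid x))$ has a minimal element $\tilde Q_t(\cdot\mid x)$ with respect to first-order stochastic dominance. Then the risk-averse problem has the same value functions and the same optimal policies as the risk-neutral problem (in which each one-step risk measure is the conditional expectation) with transition kernels $\tilde Q_t(\cdot\mid x)$ and identical cost functions.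
   Context: Setting. The horizon is $\{0,\dots,T\}$. $\{X_t\}_{t=0}^T$ is a Markov process on a probability space $(\Omega,\mathcal F,P_0)$ with state space $\mathcal X\cup\{\mathcal T\}$, where $\mathcal X\subseteq\mathbb R^n$ and $\mathcal T$ is an absorbing, cost-free terminal state; $\{\mathcal F_t\}$ is the filtration generated by $\{X_t\}$ and $\mathcal Z_t$ is the space of $\mathcal F_t$-measurable random variables. At each $t<T$ in state $x\in\mathcal X$ one either stops ($S$), paying $s_t(x)$ and moving to $\mathcal T$, or continues ($C$), paying $c_t(x)$ and moving according to the Markov transition kernel $Q_t(\cdot\mid x)$ on $\mathcal X$; $s_T$ is the cost at time $T$. Here $s_t,c_t:\mathcal X\to\mathbb R$. For fixed $x\in\mathcal X$, $\tilde X_{t+1}(x)$ denotes a random variable with law $Q_t(\cdot\mid x)$, representing the transition from state $x$ at time $t$, and $\rho_t(v(\tilde X_{t+1}(x)))$ is the one-step risk of $v$ of the next state, given state $x$ at time $t$. Risk measures. For $t=0,\dots,T-1$, $\rho_t:\mathcal Z_{t+1}\to\mathcal Z_t$ is a coherent one-step (conditional) risk measure: (convexity) $\rho_t(\lambda Z+(1-\lambda)W)\le\lambda\rho_t(Z)+(1-\lambda)\rho_t(W)$ for $\lambda\in[0,1]$, $Z,W\in\mathcal Z_{t+1}$; (monotonicity) $Z\le W$ a.s. implies $\rho_t(Z)\le\rho_t(W)$ for $Z,W\in\mathcal Z_{t+1}$; (translational invariance) $\rho_t(Z+W)=Z+\rho_t(W)$ for $Z\in\mathcal Z_t$, $W\in\mathcal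 Z_{t+1}$; (positive homogeneity) $\rho_t(\lambda W)=\lambda\rho_t(W)$ for $\lambda\ge0$, $W\in\mathcal Z_{t+1}$. It is distribution-invariant if $\rho_t(Z)=\rho_t(W)$ whenever $Z,W\in\mathcal Z_{t+1}$ are equal in distribution. Risk envelope. $\mathcal A_t(Q_t(\cdot\mid x))$ is the closed convex set of probability measures on $\mathcal X$ associated with $\rho_t$ and $Q_t(\cdot\mid x)$ in the dual representation $\rho_t(v(\tilde X_{t+1}(x)))=\sup_{P\in\mathcal A_t(Q_t(\cdot\mid x))}\int_{\mathcal X}v(y)\,P(dy)$ for measurable $v:\mathcal X\to\mathbb R$. Policies and value functions. A policy is $d=(d_0,\dots,d_{T-1})$ with $d_t:\mathcal X\to\{S,C\}$. With $z_t(x,S)=s_t(x)$ and $z_t(x,C)=c_t(x)$, its risk is $$J(d,x_0)=z_0(x_0,d_0(x_0))+\rho_0\big(z_1(X_1,d_1(X_1))+\rho_1(z_2(X_2,d_2(X_2))+\cdots+z_{T-1}(X_{T-1},d_{T-1}(X_{T-1}))+\rho_{T-1}(s_T(X_T))\cdots)\big),$$ with no cost incurred after stopping. A policy $d^*$ is optimal if $d^*\in\arg\min_dJ(d,x)$ for all $x\in\mathcal X$. The value functions are $v_T(x)=s_T(x)$ and, for $t<T$, $v_t(x)=\min\{s_t(x),\,c_t(x)+\rho_t(v_{t+1}(\tilde X_{t+1}(x)))\}$; under suitable regularity of kernels, risk mappings and costs, which is assumed, this dynamic programming recursion solves $v_0(x)=\min_dJ(d,x)$. Order notions. $x\preceq_c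 x'$ iff $x_i\le x_i'$ for all $i$. A function $v:\mathcal X\to\mathbb R$ is increasing (resp. decreasing) if $x\preceq_c x'$ implies $v(x)\le v(x')$ (resp. $v(x)\ge v(x')$). For $\mathcal X$-valued random variables (or their laws), $Y\preceq_{sd}X$ ($X$ first-order stochastically dominates $Y$) means $\mathbb E(v(X))\ge\mathbb E(v(Y))$ for every increasing $v:\mathcal X\to\mathbb R$. The kernel $Q_t$ is stochastically increasing if $x\preceq_c x'$ implies $\tilde X_{t+1}(x)\preceq_{sd}\tilde X_{t+1}(x')$.
   Formalization: Assumes a fresh uniform variable at each step, conditional law-invariance and a least envelope element; optimal policies agree when optimal from every stage and state; for stage-0 optimality, risk-averse implies risk-neutral, the converse if the envelope is absolutely continuous w.r.t. Q̃. *)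

theory Defs
  imports "HOL-Probability.Probability"
begin

section \<open>Stopping problems, policies and value functions\<close>

datatype action = Stop | Continue

definition state_space :: "(real ^ 'n) set \<Rightarrow> (real ^ 'n) measure" where
  "state_space X = restrict_space borel X"

definition kernel :: "(real ^ 'n) set \<Rightarrow> (real ^ 'n \<Rightarrow> (real ^ 'n) measure) \<Rightarrow> bool" where
  "kernel X K \<longleftrightarrow> K \<in> state_space X \<rightarrow>\<^sub>M prob_algebra (state_space X)"

definition policy ::
    "(real ^ 'n) set \<Rightarrow> nat \<Rightarrow> (nat \<Rightarrow> real ^ 'n \<Rightarrow> action) \<Rightarrow> bool" where
  "policy X T d \<longleftrightarrow> (\<forall>t<T. d t \<in> state_space X \<rightarrow>\<^sub>M count_space UNIV)"

fun stage_cost :: "(nat \<Rightarrow> 'x \<Rightarrow> real) \<Rightarrow> (nat \<Rightarrow> 'x \<Rightarrow> real) \<Rightarrow> nat \<Rightarrow> 'x \<Rightarrow> action \<Rightarrow> real" where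
  "stage_cost s c t x Stop = s t x"
| "stage_cost s c t x Continue = c t x"

text \<open>
  A one-step evaluation \<open>r\<close> assigns to a time \<open>t\<close>, a state \<open>x\<close> and a function \<open>v\<close> of the next state
  the risk \<open>r t x v\<close> of \<open>v\<close> given state \<open>x\<close> at time \<open>t\<close>. The risk-averse and the risk-neutral
  problem differ only in this argument.

  \<open>risk_to_go T s c r d t x\<close> is the part of the nested expression
  \[ z_0(x_0,d_0(x_0)) + \rho_0(z_1(X_1,d_1(X_1)) + \rho_1(\cdots + \rho_{T-1}(s_T(X_T))\cdots)) \]
  from stage \<open>t\<close> on, every one-step risk being evaluated given the current state. Stopping moves
  to an absorbing cost-free state, so that nothing is added to the cost of stopping.
\<close>

function risk_to_go ::
    "nat \<Rightarrow> (nat \<Rightarrow> 'x \<Rightarrow> real) \<Rightarrow> (nat \<Rightarrow> 'x \<Rightarrow> real) \<Rightarrow> (nat \<Rightarrow> 'x \<Rightarrow> ('x \<Rightarrow> real) \<Rightarrow> real)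
      \<Rightarrow> (nat \<Rightarrow> 'x \<Rightarrow> action) \<Rightarrow> nat \<Rightarrow> 'x \<Rightarrow> real" where
  "risk_to_go T s c r d t =
     (if T \<le> t then s T
      else (\<lambda>x. stage_cost s c t x (d t x) +
                (if d t x = Stop then 0 else r t x (risk_to_go T s c r d (Suc t)))))"
  by auto
termination
  by (relation "Wellfounded.measure (\<lambda>(T, s, c, r, d, t). T - t)") auto

declare risk_to_go.simps [simp del]

abbreviation policy_risk ::
    "nat \<Rightarrow> (nat \<Rightarrow> 'x \<Rightarrow> real) \<Rightarrow> (nat \<Rightarrow> 'x \<Rightarrow> real) \<Rightarrow> (nat \<Rightarrow> 'x \<Rightarrow> ('x \<Rightarrow> real) \<Rightarrow> real)
      \<Rightarrow> (nat \<Rightarrow> 'x \<Rightarrow> action) \<Rightarrow> 'x \<Rightarrow> real" where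
  "policy_risk T s c r d x0 \<equiv> risk_to_go T s c r d 0 x0"

function value_function ::
    "nat \<Rightarrow> (nat \<Rightarrow> 'x \<Rightarrow> real) \<Rightarrow> (nat \<Rightarrow> 'x \<Rightarrow> real) \<Rightarrow> (nat \<Rightarrow> 'x \<Rightarrow> ('x \<Rightarrow> real) \<Rightarrow> real)
      \<Rightarrow> nat \<Rightarrow> 'x \<Rightarrow> real" where
  "value_function T s c r t =
     (if T \<le> t then s T
      else (\<lambda>x. min (s t x) (c t x + r t x (value_function T s c r (Suc t)))))"
  by auto
termination
  by (relation "Wellfounded.measure (\<lambda>(T, s, c, r, t). T - t)") auto

declare value_function.simps [simp del]

definition optimal_policy ::
    "(real ^ 'n) set \<Rightarrow> nat \<Rightarrow> (nat \<Rightarrow> real ^ 'n \<Rightarrow> real) \<Rightarrow> (nat \<Rightarrow> real ^ 'n \<Rightarrow> real)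
      \<Rightarrow> (nat \<Rightarrow> real ^ 'n \<Rightarrow> (real ^ 'n \<Rightarrow> real) \<Rightarrow> real) \<Rightarrow> (nat \<Rightarrow> real ^ 'n \<Rightarrow> action) \<Rightarrow> bool" where
  "optimal_policy X T s c r d \<longleftrightarrow> policy X T d \<and>
     (\<forall>x\<in>X. \<forall>d'. policy X T d' \<longrightarrow> policy_risk T s c r d x \<le> policy_risk T s c r d' x)"

text \<open>
  Optimality in the problem started at any stage \<open>t < T\<close> in any state. A policy that is merely
  optimal from stage \<open>0\<close> may act arbitrarily in states that cannot be reached; which states these
  are depends on the one-step evaluation.
\<close>

definition stagewise_optimal_policy ::
    "(real ^ 'n) set \<Rightarrow> nat \<Rightarrow> (nat \<Rightarrow> real ^ 'n \<Rightarrow> real) \<Rightarrow> (nat \<Rightarrow> real ^ 'n \<Rightarrow> real)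
      \<Rightarrow> (nat \<Rightarrow> real ^ 'n \<Rightarrow> (real ^ 'n \<Rightarrow> real) \<Rightarrow> real) \<Rightarrow> (nat \<Rightarrow> real ^ 'n \<Rightarrow> action) \<Rightarrow> bool" where
  "stagewise_optimal_policy X T s c r d \<longleftrightarrow> policy X T d \<and>
     (\<forall>t<T. \<forall>x\<in>X. \<forall>d'. policy X T d' \<longrightarrow>
        risk_to_go T s c r d t x \<le> risk_to_go T s c r d' t x)"


section \<open>First-order stochastic dominance\<close>

text \<open>
  \<open>stoch_le X P R\<close>: the law \<open>R\<close> dominates the law \<open>P\<close>. As usual, only those increasing functions are
  considered for which both expectations exist. The order on \<open>real ^ 'n\<close> is the componentwise one.
\<close>

definition stoch_le :: "(real ^ 'n) set \<Rightarrow> (real ^ 'n) measure \<Rightarrow> (real ^ 'n) measure \<Rightarrow> bool" where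
  "stoch_le X P R \<longleftrightarrow>
     (\<forall>v :: real ^ 'n \<Rightarrow> real. v \<in> borel_measurable (state_space X) \<longrightarrow> mono_on X v \<longrightarrow>
        integrable P v \<longrightarrow> integrable R v \<longrightarrow> (\<integral>y. v y \<partial>P) \<le> (\<integral>y. v y \<partial>R))"

definition stoch_increasing ::
    "(real ^ 'n) set \<Rightarrow> (real ^ 'n \<Rightarrow> (real ^ 'n) measure) \<Rightarrow> bool" where
  "stoch_increasing X K \<longleftrightarrow> (\<forall>x\<in>X. \<forall>x'\<in>X. x \<le> x' \<longrightarrow> stoch_le X (K x) (K x'))"

definition stoch_least ::
    "(real ^ 'n) set \<Rightarrow> (real ^ 'n) measure set \<Rightarrow> (real ^ 'n) measure \<Rightarrow> bool" where
  "stoch_least X \<A> P \<longleftrightarrow> P \<in> \<A> \<and> (\<forall>R\<in>\<A>. stoch_le X P R)"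


section \<open>Conditional risk measures\<close>

text \<open>
  A finite coherent risk measure cannot be defined on all random variables of an atomless
  probability space. The random variables to be evaluated are therefore taken from a solid,
  rearrangement-invariant linear space \<open>L\<close> with constants, such as any \<open>L\<^sup>p\<close>.
\<close>

definition risk_space :: "'w measure \<Rightarrow> ('w \<Rightarrow> real) set \<Rightarrow> bool" where
  "risk_space M L \<longleftrightarrow> L \<subseteq> borel_measurable M \<and>
     (\<forall>a. (\<lambda>_. a) \<in> L) \<and>
     (\<forall>Z\<in>L. \<forall>W\<in>L. (\<lambda>\<omega>. Z \<omega> + W \<omega>) \<in> L) \<and>
     (\<forall>a. \<forall>Z\<in>L. (\<lambda>\<omega>. a * Z \<omega>) \<in> L) \<and>
     (\<forall>Z\<in>L. \<forall>W\<in>borel_measurable M. (AE \<omega> in M. \<bar>W \<omega>\<bar> \<le> \<bar>Z \<omega>\<bar>) \<longrightarrow> W \<in> L) \<and>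
     (\<forall>Z\<in>L. \<forall>W\<in>borel_measurable M. distr M borel W = distr M borel Z \<longrightarrow> W \<in> L)"

abbreviation risks_at :: "('w \<Rightarrow> real) set \<Rightarrow> (nat \<Rightarrow> 'w measure) \<Rightarrow> nat \<Rightarrow> ('w \<Rightarrow> real) set" where
  "risks_at L F t \<equiv> L \<inter> borel_measurable (F t)"

definition coherent_risk_measure ::
    "'w measure \<Rightarrow> (nat \<Rightarrow> 'w measure) \<Rightarrow> ('w \<Rightarrow> real) set \<Rightarrow> nat
      \<Rightarrow> (('w \<Rightarrow> real) \<Rightarrow> 'w \<Rightarrow> real) \<Rightarrow> bool" where
  "coherent_risk_measure M F L t \<rho> \<longleftrightarrow>
     (\<forall>Z\<in>risks_at L F (Suc t). \<rho> Z \<in> risks_at L F t) \<and>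
     (\<forall>Z\<in>risks_at L F (Suc t). \<forall>W\<in>risks_at L F (Suc t). \<forall>l\<in>{0..1}.
        AE \<omega> in M. \<rho> (\<lambda>\<omega>. l * Z \<omega> + (1 - l) * W \<omega>) \<omega> \<le> l * \<rho> Z \<omega> + (1 - l) * \<rho> W \<omega>) \<and>
     (\<forall>Z\<in>risks_at L F (Suc t). \<forall>W\<in>risks_at L F (Suc t).
        (AE \<omega> in M. Z \<omega> \<le> W \<omega>) \<longrightarrow> (AE \<omega> in M. \<rho> Z \<omega> \<le> \<rho> W \<omega>)) \<and>
     (\<forall>Z\<in>risks_at L F t. \<forall>W\<in>risks_at L F (Suc t).
        AE \<omega> in M. \<rho> (\<lambda>\<omega>. Z \<omega> + W \<omega>) \<omega> = Z \<omega> + \<rho> W \<omega>) \<and>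
     (\<forall>W\<in>risks_at L F (Suc t). \<forall>l\<ge>0. AE \<omega> in M. \<rho> (\<lambda>\<omega>. l * W \<omega>) \<omega> = l * \<rho> W \<omega>)"

definition same_conditional_distribution ::
    "'w measure \<Rightarrow> 'w measure \<Rightarrow> ('w \<Rightarrow> real) \<Rightarrow> ('w \<Rightarrow> real) \<Rightarrow> bool" where
  "same_conditional_distribution M G Z W \<longleftrightarrow>
     (\<forall>B\<in>sets borel. AE \<omega> in M.
        real_cond_exp M G (indicator (Z -` B \<inter> space M)) \<omega> =
        real_cond_exp M G (indicator (W -` B \<inter> space M)) \<omega>)"

text \<open>
  Equality of the unconditional laws would be too weak a premise: by translation invariance
  \<open>\<rho> Z = Z + \<rho> 0\<close> for every \<open>Z\<close> known at time \<open>t\<close>, so not even the conditional expectation would be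
  distribution-invariant.
\<close>

definition distribution_invariant ::
    "'w measure \<Rightarrow> (nat \<Rightarrow> 'w measure) \<Rightarrow> ('w \<Rightarrow> real) set \<Rightarrow> nat
      \<Rightarrow> (('w \<Rightarrow> real) \<Rightarrow> 'w \<Rightarrow> real) \<Rightarrow> bool" where
  "distribution_invariant M F L t \<rho> \<longleftrightarrow>
     (\<forall>Z\<in>risks_at L F (Suc t). \<forall>W\<in>risks_at L F (Suc t).
        same_conditional_distribution M (F t) Z W \<longrightarrow> (AE \<omega> in M. \<rho> Z \<omega> = \<rho> W \<omega>))"

text \<open>
  \<open>Y\<close> is observed at time \<open>t + 1\<close>, takes values in \<open>N\<close>, has law \<open>P\<close> and is independent of the
  information available at time \<open>t\<close>. With \<open>P\<close> uniform on the unit interval, the existence of such a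
  variable says that every law can be realised, and any two stochastically ordered laws on the
  reals can be coupled, by random variables to which distribution-invariance at time \<open>t\<close> applies.
\<close>

definition fresh_variable ::
    "'w measure \<Rightarrow> (nat \<Rightarrow> 'w measure) \<Rightarrow> nat \<Rightarrow> 'y measure \<Rightarrow> ('w \<Rightarrow> 'y) \<Rightarrow> 'y measure \<Rightarrow> bool" where
  "fresh_variable M F t N Y P \<longleftrightarrow>
     Y \<in> F (Suc t) \<rightarrow>\<^sub>M N \<and> distr M N Y = P \<and>
     prob_space.indep_set M (sets (F t)) (sets (vimage_algebra (space M) Y N))"

text \<open>
  The one-step risk of \<open>v\<close> given state \<open>x\<close> at time \<open>t\<close>, where \<open>Y t x\<close> represents the next state. It is
  the almost sure value of a conditional risk that does not depend on the past.
\<close>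

definition one_step_risk ::
    "'w measure \<Rightarrow> (nat \<Rightarrow> ('w \<Rightarrow> real) \<Rightarrow> 'w \<Rightarrow> real) \<Rightarrow> (nat \<Rightarrow> 'x \<Rightarrow> 'w \<Rightarrow> 'x)
      \<Rightarrow> nat \<Rightarrow> 'x \<Rightarrow> ('x \<Rightarrow> real) \<Rightarrow> real" where
  "one_step_risk M \<rho> Y t x v = (THE a. AE \<omega> in M. \<rho> t (\<lambda>\<omega>. v (Y t x \<omega>)) \<omega> = a)"

definition one_step_expectation ::
    "(nat \<Rightarrow> 'x \<Rightarrow> 'x measure) \<Rightarrow> nat \<Rightarrow> 'x \<Rightarrow> ('x \<Rightarrow> real) \<Rightarrow> real" where
  "one_step_expectation K t x v = (\<integral>y. v y \<partial>K t x)"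


section \<open>Risk envelopes\<close>

text \<open>
  The functions of the next state \<open>Y\<close> whose risk is defined.
\<close>

definition admissible :: "(real ^ 'n) set \<Rightarrow> ('w \<Rightarrow> real) set \<Rightarrow> ('w \<Rightarrow> real ^ 'n)
      \<Rightarrow> (real ^ 'n \<Rightarrow> real) set" where
  "admissible X L Y = {v \<in> borel_measurable (state_space X). (\<lambda>\<omega>. v (Y \<omega>)) \<in> L}"

definition convex_laws :: "(real ^ 'n) set \<Rightarrow> (real ^ 'n) measure set \<Rightarrow> bool" where
  "convex_laws X \<A> \<longleftrightarrow>
     (\<forall>P\<in>\<A>. \<forall>P'\<in>\<A>. \<forall>l\<in>{0..1}. \<exists>R\<in>\<A>. \<forall>B\<in>sets (state_space X).
        measure R B = l * measure P B + (1 - l) * measure P' B)"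

text \<open>
  Closedness in the coarsest topology on probability measures that makes the integrals of the
  functions in \<open>V\<close> continuous. For \<open>L\<^sup>p\<close> spaces with finite \<open>p\<close> this is weak-star closedness of the
  corresponding set of densities.
\<close>

definition closed_laws ::
    "(real ^ 'n) set \<Rightarrow> (real ^ 'n \<Rightarrow> real) set \<Rightarrow> (real ^ 'n) measure set \<Rightarrow> bool" where
  "closed_laws X V \<A> \<longleftrightarrow>
     (\<forall>P\<in>space (prob_algebra (state_space X)). (\<forall>v\<in>V. integrable P v) \<longrightarrow>
        (\<forall>W e. finite W \<longrightarrow> W \<subseteq> V \<longrightarrow> e > 0 \<longrightarrow>
           (\<exists>P'\<in>\<A>. \<forall>v\<in>W. \<bar>(\<integral>y. v y \<partial>P') - (\<integral>y. v y \<partial>P)\<bar> < e)) \<longrightarrow> P \<in> \<A>)"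

definition risk_envelope ::
    "'w measure \<Rightarrow> (real ^ 'n) set \<Rightarrow> ('w \<Rightarrow> real) set \<Rightarrow> (('w \<Rightarrow> real) \<Rightarrow> 'w \<Rightarrow> real)
      \<Rightarrow> ('w \<Rightarrow> real ^ 'n) \<Rightarrow> (real ^ 'n) measure set \<Rightarrow> bool" where
  "risk_envelope M X L \<rho> Y \<A> \<longleftrightarrow>
     \<A> \<noteq> {} \<and> \<A> \<subseteq> space (prob_algebra (state_space X)) \<and>
     convex_laws X \<A> \<and> closed_laws X (admissible X L Y) \<A> \<and>
     (\<forall>v\<in>admissible X L Y.
        (\<forall>P\<in>\<A>. integrable P v) \<and>
        bdd_above ((\<lambda>P. \<integral>y. v y \<partial>P) ` \<A>) \<and>
        (AE \<omega> in M. \<rho> (\<lambda>\<omega>. v (Y \<omega>)) \<omega> = (SUP P\<in>\<A>. \<integral>y. v y \<partial>P)))"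


section \<open>Regularity\<close>

text \<open>
  All one-step risks in the nested risk of a policy are risks of elements of \<open>L\<close>, and the
  risks-to-go are measurable functions of the state.
\<close>

definition well_posed ::
    "(real ^ 'n) set \<Rightarrow> nat \<Rightarrow> ('w \<Rightarrow> real) set \<Rightarrow> (nat \<Rightarrow> real ^ 'n \<Rightarrow> 'w \<Rightarrow> real ^ 'n)
      \<Rightarrow> (nat \<Rightarrow> real ^ 'n \<Rightarrow> real) \<Rightarrow> (nat \<Rightarrow> real ^ 'n \<Rightarrow> real)
      \<Rightarrow> (nat \<Rightarrow> real ^ 'n \<Rightarrow> (real ^ 'n \<Rightarrow> real) \<Rightarrow> real) \<Rightarrow> bool" where
  "well_posed X T L Y s c r \<longleftrightarrow>
     (\<forall>t\<le>T. s t \<in> borel_measurable (state_space X)) \<and>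
     (\<forall>t<T. c t \<in> borel_measurable (state_space X)) \<and>
     (\<forall>d. policy X T d \<longrightarrow>
        (\<forall>t\<le>T. risk_to_go T s c r d t \<in> borel_measurable (state_space X)) \<and>
        (\<forall>t<T. \<forall>x\<in>X. risk_to_go T s c r d (Suc t) \<in> admissible X L (Y t x)))"

end

theory Submission
  imports Defs
begin

text \<open>
  By backward induction the value functions of the risk-averse problem are decreasing: a decreasing
  function of the next state gets stochastically smaller as the current state increases, and a
  monotone distribution-invariant risk measure respects the stochastic order, since ordered laws can
  be realised by ordered quantile transforms of one fresh uniform variable. For a decreasing function
  the supremum over the envelope is attained at its stochastically least element, so both problems
  have the same value functions \<open>v\<close>.

  For any policy with risks-to-go \<open>W\<close> and \<open>w\<close> in the risk-averse and the risk-neutral problem,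
  \<open>v \<le> w \<le> W\<close>, and the greedy policy turns both into equalities. Hence optimality means \<open>W = v\<close> or
  \<open>w = v\<close>, respectively. The former implies the latter; the converse follows by backward induction,
  the equality at the next stage being needed only almost surely for the laws in the envelope.
\<close>

section \<open>Fresh variables: transforms and conditional laws\<close>

lemma space_state_space [simp]: "space (state_space X) = X"
  by (simp add: state_space_def space_restrict_space)

lemma fresh_variable_measurable:
  assumes "fresh_variable M F t N Y P" and "subalgebra M (F (Suc t))"
  shows "Y \<in> M \<rightarrow>\<^sub>M N"
  using assms measurable_from_subalg by (auto simp: fresh_variable_def)

text \<open>The sigma-algebra generated by a function of \<open>Y\<close> is contained in the one
  generated by \<open>Y\<close>, so independence of the past is inherited.\<close>

lemma fresh_variable_compose:
  assumes M: "prob_space M" and sub: "subalgebra M (F (Suc t))"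
    and Y: "fresh_variable M F t N Y P" and g: "g \<in> N \<rightarrow>\<^sub>M K"
  shows "fresh_variable M F t K (\<lambda>\<omega>. g (Y \<omega>)) (distr P K g)"
proof -
  interpret prob_space M by (rule M)
  have YM: "Y \<in> M \<rightarrow>\<^sub>M N" by (rule fresh_variable_measurable[OF Y sub])
  have YF: "Y \<in> F (Suc t) \<rightarrow>\<^sub>M N" and P: "distr M N Y = P"
    and ind: "indep_set (sets (F t)) (sets (vimage_algebra (space M) Y N))"
    using Y by (auto simp: fresh_variable_def)
  have "sets (vimage_algebra (space M) (\<lambda>\<omega>. g (Y \<omega>)) K)
          \<subseteq> sets (vimage_algebra (space M) Y N)"
  proof
    fix A assume "A \<in> sets (vimage_algebra (space M) (\<lambda>\<omega>. g (Y \<omega>)) K)"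
    moreover have "(\<lambda>\<omega>. g (Y \<omega>)) \<in> space M \<rightarrow> space K"
      using measurable_space[OF YM] measurable_space[OF g] by auto
    ultimately obtain B where B: "B \<in> sets K" "A = (\<lambda>\<omega>. g (Y \<omega>)) -` B \<inter> space M"
      by (auto simp: sets_vimage_algebra2)
    have "A = Y -` (g -` B \<inter> space N) \<inter> space M"
      using B measurable_space[OF YM] by auto
    then show "A \<in> sets (vimage_algebra (space M) Y N)"
      using in_vimage_algebra[OF measurable_sets[OF g B(1)]] by simp
  qed
  then have "indep_set (sets (F t)) (sets (vimage_algebra (space M) (\<lambda>\<omega>. g (Y \<omega>)) K))"
    using ind unfolding indep_set_def
    by (elim indep_sets_mono_sets) (auto split: bool.split)
  moreover have "distr M K (\<lambda>\<omega>. g (Y \<omega>)) = distr P K g"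
    using distr_distr[OF g YM] by (simp add: P comp_def)
  ultimately show ?thesis
    using measurable_compose[OF YF g] by (simp add: fresh_variable_def)
qed

text \<open>By independence the constant \<open>measure P B\<close> and the indicator of the event
  have the same integral over every set of \<open>F t\<close>, which characterises the conditional
  expectation.\<close>

lemma fresh_variable_cond_prob:
  assumes M: "prob_space M" and sub: "\<And>t. subalgebra M (F t)"
    and Y: "fresh_variable M F t N Y P" and B: "B \<in> sets N"
  shows "AE \<omega> in M. real_cond_exp M (F t) (indicator (Y -` B \<inter> space M)) \<omega> = measure P B"
proof -
  interpret prob_space M by (rule M)
  interpret finite_measure_subalgebra M "F t" by standard (rule sub)
  have YM: "Y \<in> M \<rightarrow>\<^sub>M N" by (rule fresh_variable_measurable[OF Y sub])
  have P: "measure P B = prob (Y -` B \<inter> space M)"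
    using Y measure_distr[OF YM B] by (auto simp: fresh_variable_def)
  have ev: "Y -` B \<inter> space M \<in> events" by (rule measurable_sets[OF YM B])
  show ?thesis
  proof (rule real_cond_exp_charact)
    fix D assume D: "D \<in> sets (F t)"
    then have D': "D \<in> events" using sub[of t] by (auto simp: subalgebra_def)
    have "prob (D \<inter> (Y -` B \<inter> space M)) = prob D * prob (Y -` B \<inter> space M)"
      using Y D in_vimage_algebra[OF B] by (auto simp: fresh_variable_def intro!: indep_setD)
    moreover have "(LINT \<omega>:D|M. indicator (Y -` B \<inter> space M) \<omega>)
        = (LINT \<omega>|M. indicator (D \<inter> (Y -` B \<inter> space M)) \<omega> :: real)"
      unfolding set_lebesgue_integral_def
      by (intro Bochner_Integration.integral_cong) (auto simp: indicator_def)
    moreover have "(LINT \<omega>|M. indicator (D \<inter> (Y -` B \<inter> space M)) \<omega> :: real)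
        = prob (D \<inter> (Y -` B \<inter> space M))"
      by (simp add: Int_assoc)
    moreover have "(LINT \<omega>:D|M. measure P B) = measure P B * prob D"
      using D' sets.sets_into_space[OF D']
      by (simp add: set_lebesgue_integral_def Int_absorb2)
    ultimately show "(LINT \<omega>:D|M. indicator (Y -` B \<inter> space M) \<omega>) = (LINT \<omega>:D|M. measure P B)"
      by (simp add: P)
  qed (use ev in \<open>auto simp: less_top[symmetric]\<close>)
qed

text \<open>Conditioning on \<open>F t\<close> yields the same constant probabilities for both
  variables. For fresh variables, distribution-invariance therefore only requires equality of the
  ordinary laws.\<close>

lemma fresh_variable_same_conditional_distribution:
  assumes "prob_space M" and "\<And>t. subalgebra M (F t)"
    and "fresh_variable M F t borel Z P" and "fresh_variable M F t borel W P"
  shows "same_conditional_distribution M (F t) Z W"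
  unfolding same_conditional_distribution_def
proof
  fix B :: "real set" assume B: "B \<in> sets borel"
  show "AE \<omega> in M. real_cond_exp M (F t) (indicator (Z -` B \<inter> space M)) \<omega> =
        real_cond_exp M (F t) (indicator (W -` B \<inter> space M)) \<omega>"
    using fresh_variable_cond_prob[OF assms(1-3) B] fresh_variable_cond_prob[OF assms(1,2,4) B]
    by eventually_elim simp
qed

section \<open>Quantile transforms and the stochastic order\<close>

text \<open>The pseudoinverse of the cdf is only controlled on the open unit interval.\<close>

definition quantile :: "real measure \<Rightarrow> real \<Rightarrow> real" where
  "quantile P u = (if u \<in> {0<..<1} then Inf {x. u \<le> cdf P x} else 0)"

lemma quantile_measurable [measurable]:
  assumes "real_distribution P"
  shows "quantile P \<in> borel_measurable borel"
proof -
  interpret cdf_distribution P using assms by (simp add: cdf_distribution_def)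
  show ?thesis
    unfolding quantile_def[abs_def]
    using measurable_CI
    by (subst measurable_If_restrict_space_iff) (simp_all add: greaterThanLessThan_def greaterThan_def lessThan_def Collect_conj_eq)
qed

text \<open>The pseudoinverse of the cdf carries Lebesgue measure on the open unit interval to
  \<open>P\<close>. The closed interval adds only two endpoints of measure zero, so the default
  value 0 there does not affect the law.\<close>

lemma distr_quantile:
  assumes "real_distribution P"
  shows "distr (uniform_measure lborel {0..1}) borel (quantile P) = P"
proof -
  interpret cdf_distribution P using assms by (simp add: cdf_distribution_def)
  note [measurable] = quantile_measurable[OF assms]
  have "distr (uniform_measure lborel {0..1}) borel (quantile P)
      = distr (restrict_space lborel {0<..<1}) borel (\<lambda>u. Inf {x. u \<le> cdf P x})"
  proof (rule measure_eqI)
    fix B assume "B \<in> sets (distr (uniform_measure lborel {0..1}) borel (quantile P))"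
    then have B [measurable]: "B \<in> sets borel" by simp
    let ?I = "\<lambda>u. Inf {x. u \<le> cdf P x}"
    have m: "?I \<in> restrict_space lborel {0<..<1} \<rightarrow>\<^sub>M borel"
      using measurable_CI by (simp cong: measurable_cong_sets add: sets_restrict_space)
    have "emeasure (distr (uniform_measure lborel {0..1}) borel (quantile P)) B
        = emeasure lborel ({0..1} \<inter> quantile P -` B)"
      using measurable_sets_borel[OF quantile_measurable[OF assms] B]
      by (subst emeasure_distr) (auto simp: divide_ennreal_def)
    also have "\<dots> = emeasure lborel ({0<..<1} \<inter> quantile P -` B)"
    proof (rule emeasure_eq_AE)
      show "AE u in lborel. u \<in> {0..1} \<inter> quantile P -` B \<longleftrightarrow> u \<in> {0<..<1} \<inter> quantile P -` B"
        using AE_lborel_singleton[of "0::real"] AE_lborel_singleton[of "1::real"]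
        by eventually_elim auto
    qed (use measurable_sets_borel[OF quantile_measurable[OF assms] B] in auto)
    also have "{0<..<1} \<inter> quantile P -` B = ?I -` B \<inter> {0<..<1}"
      by (auto simp: quantile_def)
    also have "emeasure lborel \<dots> = emeasure (distr (restrict_space lborel {0<..<1}) borel ?I) B"
      by (subst emeasure_distr[OF m B], subst emeasure_restrict_space)
        (auto simp: space_restrict_space)
    finally show "emeasure (distr (uniform_measure lborel {0..1}) borel (quantile P)) B
        = emeasure (distr (restrict_space lborel {0<..<1}) borel ?I) B" .
  qed simp
  then show ?thesis using distr_I_eq_M by simp
qed

text \<open>On the open unit interval there is a Galois connection: \<open>u \<le> cdf P x\<close>
  holds exactly if \<open>quantile P u \<le> x\<close>. It is applied at
  \<open>x = quantile R u\<close>, first for \<open>R\<close> and then for \<open>P\<close>.\<close>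

lemma quantile_mono:
  assumes "real_distribution P" "real_distribution R" and le: "\<And>x. cdf R x \<le> cdf P x"
  shows "quantile P u \<le> quantile R u"
proof (cases "u \<in> {0<..<1}")
  case True
  interpret P: cdf_distribution P using assms by (simp add: cdf_distribution_def)
  interpret R: cdf_distribution R using assms by (simp add: cdf_distribution_def)
  have "u \<le> cdf R (quantile R u)"
    using True R.pseudoinverse[of u "quantile R u"] by (simp add: quantile_def)
  then have "u \<le> cdf P (quantile R u)" using le order_trans by blast
  then show ?thesis using True P.pseudoinverse[of u "quantile R u"] by (simp add: quantile_def)
next
  case False
  then show ?thesis by (simp add: quantile_def del: greaterThanLessThan_iff)
qed

text \<open>
  The two variables need not be comparable pointwise; distribution-invariance allows replacing them
  by the comonotone pair of quantile transforms of one uniform variable.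
\<close>

lemma risk_mono_stochastic_order:
  assumes M: "prob_space M" and sub: "\<And>t. subalgebra M (F t)"
    and U: "fresh_variable M F t borel U (uniform_measure lborel {0..1::real})"
    and L: "risk_space M L" and coh: "coherent_risk_measure M F L t \<rho>"
    and inv: "distribution_invariant M F L t \<rho>"
    and Z: "fresh_variable M F t borel Z P" "Z \<in> L"
    and W: "fresh_variable M F t borel W R" "W \<in> L"
    and le: "\<And>a. cdf R a \<le> cdf P a"
  shows "AE \<omega> in M. \<rho> Z \<omega> \<le> \<rho> W \<omega>"
proof -
  interpret prob_space M by (rule M)
  have transform: "real_distribution S \<and> (\<lambda>\<omega>. quantile S (U \<omega>)) \<in> risks_at L F (Suc t) \<and>
      (AE \<omega> in M. \<rho> V \<omega> = \<rho> (\<lambda>\<omega>. quantile S (U \<omega>)) \<omega>) "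
    if V: "fresh_variable M F t borel V S" "V \<in> L" for V S
  proof -
    have VM: "V \<in> borel_measurable M" by (rule fresh_variable_measurable[OF V(1) sub])
    have S: "distr M borel V = S" and VF: "V \<in> borel_measurable (F (Suc t))"
      using V(1) by (auto simp: fresh_variable_def)
    then have rd: "real_distribution S" using VM real_distribution_distr by blast
    have fr: "fresh_variable M F t borel (\<lambda>\<omega>. quantile S (U \<omega>)) S"
      using fresh_variable_compose[OF M sub U quantile_measurable[OF rd]] distr_quantile[OF rd]
      by simp
    then have same_law: "distr M borel (\<lambda>\<omega>. quantile S (U \<omega>)) = distr M borel V"
      and QF: "(\<lambda>\<omega>. quantile S (U \<omega>)) \<in> borel_measurable (F (Suc t))"
      by (auto simp: fresh_variable_def S)
    \<comment> \<open>The quantile transform need not be dominated by \<open>V\<close>. It lies in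
      \<open>L\<close> because \<open>L\<close> is closed under passing to variables with the same
      law.\<close>
    have "\<forall>Z\<in>L. \<forall>W\<in>borel_measurable M. distr M borel W = distr M borel Z \<longrightarrow> W \<in> L"
      using L unfolding risk_space_def by (elim conjE)
    then have QL: "(\<lambda>\<omega>. quantile S (U \<omega>)) \<in> L"
      using V(2) fresh_variable_measurable[OF fr sub] same_law by blast
    have "AE \<omega> in M. \<rho> V \<omega> = \<rho> (\<lambda>\<omega>. quantile S (U \<omega>)) \<omega>"
      using inv[unfolded distribution_invariant_def, rule_format, OF _ _
          fresh_variable_same_conditional_distribution[OF M sub V(1) fr]] V(2) VF QF QL
      by blast
    then show ?thesis using rd QF QL by blast
  qed
  have mono: "\<forall>Z\<in>risks_at L F (Suc t). \<forall>W\<in>risks_at L F (Suc t).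
      (AE \<omega> in M. Z \<omega> \<le> W \<omega>) \<longrightarrow> (AE \<omega> in M. \<rho> Z \<omega> \<le> \<rho> W \<omega>)"
    using coh unfolding coherent_risk_measure_def by (elim conjE)
  have "AE \<omega> in M. quantile P (U \<omega>) \<le> quantile R (U \<omega>)"
    using transform[OF Z] transform[OF W] quantile_mono[of P R] le by simp
  then have "AE \<omega> in M. \<rho> (\<lambda>\<omega>. quantile P (U \<omega>)) \<omega> \<le> \<rho> (\<lambda>\<omega>. quantile R (U \<omega>)) \<omega>"
    by (rule mono[THEN bspec, THEN bspec, THEN mp,
          OF transform[OF Z, THEN conjunct2, THEN conjunct1]
            transform[OF W, THEN conjunct2, THEN conjunct1]])
  moreover have "AE \<omega> in M. \<rho> Z \<omega> = \<rho> (\<lambda>\<omega>. quantile P (U \<omega>)) \<omega>"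
    and "AE \<omega> in M. \<rho> W \<omega> = \<rho> (\<lambda>\<omega>. quantile R (U \<omega>)) \<omega>"
    using transform[OF Z] transform[OF W] by auto
  ultimately show ?thesis by eventually_elim simp
qed

text \<open>Sublevel sets of a decreasing function are upward closed in \<open>X\<close>, so their
  indicators are bounded increasing test functions. The dominating law thus puts more mass on small
  values of \<open>v\<close>.\<close>

lemma stoch_le_cdf_antimono:
  assumes PR: "P \<in> space (prob_algebra (state_space X))" "R \<in> space (prob_algebra (state_space X))"
    and le: "stoch_le X P R" and v: "v \<in> borel_measurable (state_space X)" "antimono_on X v"
  shows "cdf (distr P borel v) a \<le> cdf (distr R borel v) a"
proof -
  interpret P: prob_space P using PR by (simp add: space_prob_algebra)
  interpret R: prob_space R using PR by (simp add: space_prob_algebra)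
  have sets: "sets P = sets (state_space X)" "sets R = sets (state_space X)"
    using PR by (auto simp: space_prob_algebra)
  have sp: "space P = X" "space R = X"
    using sets[THEN sets_eq_imp_space_eq] by simp_all
  let ?B = "v -` {..a} \<inter> X"
  have B: "?B \<in> sets (state_space X)" using measurable_sets[OF v(1), of "{..a}"] by simp
  have "(\<integral>y. indicator ?B y \<partial>P) \<le> (\<integral>y. indicator ?B y \<partial>R :: real)"
    using le unfolding stoch_le_def
  proof (elim allE[of _ "indicator ?B"] impE)
    show "mono_on X (indicator ?B :: _ \<Rightarrow> real)"
      using v(2) by (auto simp: monotone_on_def indicator_def) (meson order_trans)
  qed (use B sets in \<open>auto simp: less_top[symmetric]\<close>)
  moreover have "v \<in> borel_measurable P" "v \<in> borel_measurable R"
    using v(1) sets by (auto cong: measurable_cong_sets)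
  ultimately show ?thesis
    by (simp add: cdf_def measure_distr sp Int_absorb2)
qed

section \<open>One-step risk, dynamic programming recursions and the greedy policy\<close>

text \<open>The definite description is unambiguous: on a probability space, two constants that
  agree almost surely with the same variable are equal.\<close>

lemma one_step_risk_eqI:
  assumes "prob_space M" and ae: "AE \<omega> in M. \<rho> t (\<lambda>\<omega>. v (Y t x \<omega>)) \<omega> = a"
  shows "one_step_risk M \<rho> Y t x v = a"
proof -
  interpret prob_space M by fact
  show ?thesis
    unfolding one_step_risk_def
  proof (rule the_equality)
    show "AE \<omega> in M. \<rho> t (\<lambda>\<omega>. v (Y t x \<omega>)) \<omega> = a" by (rule ae)
  next
    fix b assume "AE \<omega> in M. \<rho> t (\<lambda>\<omega>. v (Y t x \<omega>)) \<omega> = b"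
    with ae have "AE \<omega> in M. b = a" by eventually_elim simp
    then show "b = a" by simp
  qed
qed

lemma risk_to_go_horizon: "risk_to_go T s c r d T = s T"
  by (simp add: risk_to_go.simps)

lemma risk_to_go_step:
  assumes "t < T"
  shows "risk_to_go T s c r d t x =
    (if d t x = Stop then s t x else c t x + r t x (risk_to_go T s c r d (Suc t)))"
  using assms by (subst risk_to_go.simps) (cases "d t x"; simp)

lemma value_function_horizon: "value_function T s c r T = s T"
  by (simp add: value_function.simps)

lemma value_function_step:
  assumes "t < T"
  shows "value_function T s c r t x = min (s t x) (c t x + r t x (value_function T s c r (Suc t)))"
  using assms by (subst value_function.simps) simp

definition greedy ::
    "nat \<Rightarrow> (nat \<Rightarrow> 'x \<Rightarrow> real) \<Rightarrow> (nat \<Rightarrow> 'x \<Rightarrow> real) \<Rightarrow> (nat \<Rightarrow> 'x \<Rightarrow> ('x \<Rightarrow> real) \<Rightarrow> real)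
      \<Rightarrow> nat \<Rightarrow> 'x \<Rightarrow> action" where
  "greedy T s c r t x =
     (if s t x \<le> c t x + r t x (value_function T s c r (Suc t)) then Stop else Continue)"

text \<open>The two recursions coincide as soon as the chosen action attains the minimum, for any
  evaluation \<open>r\<close> and in every state. Greediness is required only from stage
  \<open>t\<close> on, which covers the partially greedy policies in
  \<open>policy_greedy\<close>.\<close>

lemma risk_to_go_greedy:
  assumes "t \<le> T" and "\<And>u. t \<le> u \<Longrightarrow> u < T \<Longrightarrow> d u = greedy T s c r u"
  shows "risk_to_go T s c r d t = value_function T s c r t"
  using assms(1)
proof (induction rule: inc_induct)
  case base
  show ?case by (simp add: risk_to_go_horizon value_function_horizon)
next
  case (step u)
  then have "d u = greedy T s c r u" using assms(2) by simp
  with step show ?case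
    by (intro ext) (simp add: risk_to_go_step value_function_step greedy_def min_def)
qed

text \<open>
  Well-posedness only speaks about policies. Applied to policies that are greedy from some stage on
  and continue before, it yields the measurability of the greedy rule one stage earlier.
\<close>

lemma policy_greedy:
  assumes wp: "well_posed X T L Y s c r"
  shows "policy X T (greedy T s c r)"
proof -
  define d where "d k t = (if k \<le> t then greedy T s c r t else (\<lambda>_. Continue))" for k t
  have "policy X T (d 0)"
    using le0[of T]
  proof (induction rule: inc_induct)
    case base
    show ?case by (simp add: policy_def d_def)
  next
    case (step k)
    let ?v = "value_function T s c r (Suc k)"
    have "risk_to_go T s c r (d (Suc k)) (Suc k) = ?v"
      using step by (intro risk_to_go_greedy) (auto simp: d_def)
    \<comment> \<open>Continuing at stage \<open>k\<close> makes the risk-to-go equal to the very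
      continuation value with which the greedy rule compares \<open>s k\<close>.\<close>
    moreover have "d (Suc k) k = (\<lambda>_. Continue)" by (simp add: d_def)
    ultimately have "risk_to_go T s c r (d (Suc k)) k = (\<lambda>x. c k x + r k x ?v)"
      using step by (intro ext) (simp add: risk_to_go_step)
    moreover have "risk_to_go T s c r (d (Suc k)) k \<in> borel_measurable (state_space X)"
      using wp step by (simp add: well_posed_def)
    ultimately have [measurable]: "(\<lambda>x. c k x + r k x ?v) \<in> borel_measurable (state_space X)"
      by simp
    have [measurable]: "s k \<in> borel_measurable (state_space X)"
      using wp step by (simp add: well_posed_def)
    have "greedy T s c r k \<in> state_space X \<rightarrow>\<^sub>M count_space UNIV"
      unfolding greedy_def[abs_def] by measurable
    moreover have "d k = (d (Suc k))(k := greedy T s c r k)"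
      by (auto simp: fun_eq_iff d_def)
    ultimately show ?case
      using step.IH by (simp add: policy_def)
  qed
  moreover have "d 0 = greedy T s c r" by (simp add: fun_eq_iff d_def)
  ultimately show ?thesis by simp
qed

section \<open>One-step risks of decreasing functions\<close>

locale monotone_stopping = prob_space M
  for M :: "'w measure" +
  fixes X :: "(real ^ 'n) set"
    and T :: nat
    and F :: "nat \<Rightarrow> 'w measure"
    and L :: "('w \<Rightarrow> real) set"
    and Q Qm :: "nat \<Rightarrow> real ^ 'n \<Rightarrow> (real ^ 'n) measure"
    and Y :: "nat \<Rightarrow> real ^ 'n \<Rightarrow> 'w \<Rightarrow> real ^ 'n"
    and \<rho> :: "nat \<Rightarrow> ('w \<Rightarrow> real) \<Rightarrow> 'w \<Rightarrow> real"
    and A :: "nat \<Rightarrow> (real ^ 'n) measure \<Rightarrow> (real ^ 'n) measure set"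
    and s c :: "nat \<Rightarrow> real ^ 'n \<Rightarrow> real"
  assumes sub: "\<And>t. subalgebra M (F t)"
    and rich: "\<And>t. t < T \<Longrightarrow> \<exists>U. fresh_variable M F t borel U (uniform_measure lborel {0..1::real})"
    and risks: "risk_space M L"
    and kernel_Q: "\<And>t. t < T \<Longrightarrow> kernel X (Q t)"
    and fresh: "\<And>t x. t < T \<Longrightarrow> x \<in> X \<Longrightarrow> fresh_variable M F t (state_space X) (Y t x) (Q t x)"
    and coherent: "\<And>t. t < T \<Longrightarrow> coherent_risk_measure M F L t (\<rho> t)"
    and envelope: "\<And>t x. t < T \<Longrightarrow> x \<in> X \<Longrightarrow> risk_envelope M X L (\<rho> t) (Y t x) (A t (Q t x))"
    and wp: "well_posed X T L Y s c (one_step_risk M \<rho> Y)"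
    and invariant: "\<And>t. t < T \<Longrightarrow> distribution_invariant M F L t (\<rho> t)"
    and increasing: "\<And>t. t < T \<Longrightarrow> stoch_increasing X (Q t)"
    and c_antimono: "\<And>t. t < T \<Longrightarrow> antimono_on X (c t)"
    and s_antimono: "\<And>t. t \<le> T \<Longrightarrow> antimono_on X (s t)"
    and least: "\<And>t x. t < T \<Longrightarrow> x \<in> X \<Longrightarrow> stoch_least X (A t (Q t x)) (Qm t x)"
    and kernel_Qm: "\<And>t. t < T \<Longrightarrow> kernel X (Qm t)"
begin

abbreviation "averse \<equiv> one_step_risk M \<rho> Y"
abbreviation "neutral \<equiv> one_step_expectation Qm"
abbreviation "v \<equiv> value_function T s c averse"

lemma envelope_law:
  assumes "t < T" "x \<in> X" "P \<in> A t (Q t x)"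
  shows "prob_space P" "sets P = sets (state_space X)" "space P = X"
proof -
  show "prob_space P" and s: "sets P = sets (state_space X)"
    using envelope[OF assms(1,2)] assms(3) by (auto simp: risk_envelope_def space_prob_algebra)
  show "space P = X" using sets_eq_imp_space_eq[OF s] by simp
qed

lemma Qm_in_envelope: "t < T \<Longrightarrow> x \<in> X \<Longrightarrow> Qm t x \<in> A t (Q t x)"
  using least by (auto simp: stoch_least_def)

lemma Qm_law:
  assumes "t < T" "x \<in> X"
  shows "sets (Qm t x) = sets (state_space X)" "space (Qm t x) = X"
  using envelope_law(2,3)[OF assms Qm_in_envelope[OF assms]] by simp_all

lemma envelope_integrable:
  assumes "t < T" "x \<in> X" "P \<in> A t (Q t x)" "f \<in> admissible X L (Y t x)"
  shows "integrable P f"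
  using envelope[OF assms(1,2)] assms(3,4) by (auto simp: risk_envelope_def)

text \<open>The dual representation supplies the constant sought by the definite description in
  \<open>one_step_risk\<close>, namely the supremum over the envelope.\<close>

lemma risk_AE_eq_averse:
  assumes tx: "t < T" "x \<in> X" and f: "f \<in> admissible X L (Y t x)"
  shows "AE \<omega> in M. \<rho> t (\<lambda>\<omega>. f (Y t x \<omega>)) \<omega> = averse t x f"
    and "averse t x f = (SUP P\<in>A t (Q t x). \<integral>y. f y \<partial>P)"
proof -
  have ae: "AE \<omega> in M. \<rho> t (\<lambda>\<omega>. f (Y t x \<omega>)) \<omega> = (SUP P\<in>A t (Q t x). \<integral>y. f y \<partial>P)"
    using envelope[OF tx] f by (auto simp: risk_envelope_def)
  show eq: "averse t x f = (SUP P\<in>A t (Q t x). \<integral>y. f y \<partial>P)"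
    by (rule one_step_risk_eqI) (rule prob_space_axioms, rule ae)
  show "AE \<omega> in M. \<rho> t (\<lambda>\<omega>. f (Y t x \<omega>)) \<omega> = averse t x f"
    unfolding eq by (rule ae)
qed

lemma integral_le_averse:
  assumes "t < T" "x \<in> X" "P \<in> A t (Q t x)" and f: "f \<in> admissible X L (Y t x)"
  shows "(\<integral>y. f y \<partial>P) \<le> averse t x f"
  unfolding risk_AE_eq_averse(2)[OF assms(1,2) f]
  using envelope[OF assms(1,2)] assms(3) f by (auto simp: risk_envelope_def intro!: cSUP_upper)

lemma averse_le:
  assumes "t < T" "x \<in> X" and f: "f \<in> admissible X L (Y t x)"
    and "\<And>P. P \<in> A t (Q t x) \<Longrightarrow> (\<integral>y. f y \<partial>P) \<le> b"
  shows "averse t x f \<le> b"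
  unfolding risk_AE_eq_averse(2)[OF assms(1,2) f]
  using envelope[OF assms(1,2)] assms(4) by (auto simp: risk_envelope_def intro!: cSUP_least)

text \<open>Integrals under the laws of the envelope, and hence their supremum, ignore null sets of
  these laws. The comparison of policies can supply no more than such an almost sure
  premise.\<close>

lemma averse_mono_AE:
  assumes tx: "t < T" "x \<in> X"
    and f: "f \<in> admissible X L (Y t x)" and g: "g \<in> admissible X L (Y t x)"
    and le: "\<And>P. P \<in> A t (Q t x) \<Longrightarrow> AE y in P. f y \<le> g y"
  shows "averse t x f \<le> averse t x g"
proof (rule averse_le[OF tx f])
  fix P assume P: "P \<in> A t (Q t x)"
  have "(\<integral>y. f y \<partial>P) \<le> (\<integral>y. g y \<partial>P)"
    by (intro integral_mono_AE le P envelope_integrable[OF tx P] f g)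
  also have "\<dots> \<le> averse t x g" by (rule integral_le_averse[OF tx P g])
  finally show "(\<integral>y. f y \<partial>P) \<le> averse t x g" .
qed

text \<open>As the state grows, the law of a decreasing function of the next state gets
  stochastically smaller, so the conditional risks are ordered almost surely. Both are almost surely
  constant, which turns this into an inequality of numbers.\<close>

lemma averse_antimono:
  assumes f: "antimono_on X f" "f \<in> admissible X L (Y t x)" "f \<in> admissible X L (Y t x')"
    and t: "t < T" and x: "x \<in> X" "x' \<in> X" "x \<le> x'"
  shows "averse t x' f \<le> averse t x f"
proof -
  obtain U where U: "fresh_variable M F t borel U (uniform_measure lborel {0..1::real})"
    using rich[OF t] by blast
  have fm: "f \<in> borel_measurable (state_space X)"
    and fL: "(\<lambda>\<omega>. f (Y t x \<omega>)) \<in> L" "(\<lambda>\<omega>. f (Y t x' \<omega>)) \<in> L"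
    using f by (auto simp: admissible_def)
  have Q: "Q t y \<in> space (prob_algebra (state_space X))" if "y \<in> X" for y
    using measurable_space[of "Q t"] kernel_Q[OF t] that by (fastforce simp: kernel_def)
  have "stoch_le X (Q t x) (Q t x')"
    using increasing[OF t] x by (auto simp: stoch_increasing_def)
  then have le: "cdf (distr (Q t x) borel f) a \<le> cdf (distr (Q t x') borel f) a" for a
    using stoch_le_cdf_antimono Q x fm f(1) by blast
  have Z: "fresh_variable M F t borel (\<lambda>\<omega>. f (Y t y \<omega>)) (distr (Q t y) borel f)" if "y \<in> X" for y
    by (rule fresh_variable_compose[OF prob_space_axioms sub fresh[OF t that] fm])
  have "AE \<omega> in M. \<rho> t (\<lambda>\<omega>. f (Y t x' \<omega>)) \<omega> \<le> \<rho> t (\<lambda>\<omega>. f (Y t x \<omega>)) \<omega>"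
    by (rule risk_mono_stochastic_order[OF prob_space_axioms sub U risks coherent[OF t]
          invariant[OF t] Z[OF x(2)] fL(2) Z[OF x(1)] fL(1) le])
  with risk_AE_eq_averse(1)[OF t x(1) f(2)] risk_AE_eq_averse(1)[OF t x(2) f(3)]
  have "AE \<omega> in M. averse t x' f \<le> averse t x f" by eventually_elim simp
  then show ?thesis by simp
qed

text \<open>The function \<open>- f\<close> is increasing, so the stochastically least law minimises
  its integral and hence maximises that of \<open>f\<close>. This law belongs to the envelope, so
  the supremum is attained there.\<close>

lemma averse_eq_neutral:
  assumes f: "antimono_on X f" "f \<in> admissible X L (Y t x)" and tx: "t < T" "x \<in> X"
  shows "averse t x f = neutral t x f"
proof (rule antisym)
  show "averse t x f \<le> neutral t x f"
  proof (rule averse_le[OF tx f(2)])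
    fix P assume P: "P \<in> A t (Q t x)"
    then have "stoch_le X (Qm t x) P" using least[OF tx] by (auto simp: stoch_least_def)
    moreover have "(\<lambda>y. - f y) \<in> borel_measurable (state_space X)"
      using f(2) by (auto simp: admissible_def)
    moreover have "mono_on X (\<lambda>y. - f y)" using f(1) by (auto simp: monotone_on_def)
    moreover have "integrable P (\<lambda>y. - f y)" "integrable (Qm t x) (\<lambda>y. - f y)"
      using envelope_integrable[OF tx _ f(2)] P Qm_in_envelope[OF tx] by auto
    ultimately have "(\<integral>y. - f y \<partial>Qm t x) \<le> (\<integral>y. - f y \<partial>P)" unfolding stoch_le_def by blast
    then show "(\<integral>y. f y \<partial>P) \<le> neutral t x f" by (simp add: one_step_expectation_def)
  qed
  show "neutral t x f \<le> averse t x f"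
    unfolding one_step_expectation_def by (intro integral_le_averse tx Qm_in_envelope f)
qed

section \<open>Value functions of the two problems\<close>

lemma v_greedy: "t \<le> T \<Longrightarrow> risk_to_go T s c averse (greedy T s c averse) t = v t"
  by (rule risk_to_go_greedy) auto

lemma greedy_policy: "policy X T (greedy T s c averse)"
  by (rule policy_greedy[OF wp])

lemma risk_to_go_admissible:
  assumes "policy X T d" "t < T" "x \<in> X"
  shows "risk_to_go T s c averse d (Suc t) \<in> admissible X L (Y t x)"
  using wp assms by (simp add: well_posed_def)

text \<open>Well-posedness speaks of risks-to-go of policies; it reaches \<open>v\<close> because
  \<open>v\<close> is the risk-to-go of the greedy policy.\<close>

lemma v_admissible: "t < T \<Longrightarrow> x \<in> X \<Longrightarrow> v (Suc t) \<in> admissible X L (Y t x)"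
  using risk_to_go_admissible[OF greedy_policy, of t x] v_greedy[of "Suc t"] by simp

lemma v_antimono:
  assumes "t \<le> T" shows "antimono_on X (v t)"
  using assms
proof (induction rule: inc_induct)
  case base
  show ?case using s_antimono[of T] by (simp add: value_function_horizon)
next
  case (step t)
  show ?case
  proof (rule monotone_onI)
    fix x x' assume x: "x \<in> X" "x' \<in> X" "x \<le> x'"
    have "averse t x' (v (Suc t)) \<le> averse t x (v (Suc t))"
      using step x by (intro averse_antimono v_admissible) auto
    moreover have "s t x' \<le> s t x" "c t x' \<le> c t x"
      using monotone_onD[OF s_antimono[of t]] monotone_onD[OF c_antimono[of t]] step x by auto
    ultimately show "v t x' \<le> v t x"
      using step(2) by (auto simp: value_function_step min_def)
  qed
qed

lemma averse_v:
  assumes "t < T" "x \<in> X"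
  shows "averse t x (v (Suc t)) = neutral t x (v (Suc t))"
  using assms by (intro averse_eq_neutral v_antimono v_admissible) auto

lemma neutral_cong:
  assumes "t < T" "x \<in> X" and "\<And>y. y \<in> X \<Longrightarrow> f y = g y"
  shows "neutral t x f = neutral t x g"
  unfolding one_step_expectation_def
  using assms Qm_law(2)[OF assms(1,2)] by (intro Bochner_Integration.integral_cong) auto

lemma neutral_mono:
  assumes "t < T" "x \<in> X" and "integrable (Qm t x) f" "integrable (Qm t x) g"
    and "\<And>y. y \<in> X \<Longrightarrow> f y \<le> g y"
  shows "neutral t x f \<le> neutral t x g"
  unfolding one_step_expectation_def
  using assms Qm_law(2)[OF assms(1,2)] by (intro integral_mono) auto

text \<open>Agreement on \<open>X\<close> is enough to carry the induction, since
  \<open>Qm t x\<close> lives on \<open>X\<close>; at each stage \<open>averse_v\<close> then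
  exchanges the two evaluations.\<close>

lemma value_function_neutral:
  assumes "t \<le> T" "x \<in> X"
  shows "value_function T s c neutral t x = v t x"
  using assms
proof (induction arbitrary: x rule: inc_induct)
  case base
  then show ?case by (simp add: value_function_horizon)
next
  case (step t)
  have "neutral t x (value_function T s c neutral (Suc t)) = neutral t x (v (Suc t))"
    by (rule neutral_cong[OF step(2) step.prems step.IH])
  then show ?case
    by (simp only: value_function_step[OF step(2)] averse_v[OF step(2) step.prems])
qed

section \<open>Risks-to-go in the risk-neutral problem\<close>

text \<open>The bounds may take either sign, so the sum of their absolute values serves as the
  dominating function.\<close>

lemma integrable_between:
  assumes tx: "t < T" "x \<in> X" "P \<in> A t (Q t x)"
    and f: "f \<in> admissible X L (Y t x)" and g: "g \<in> admissible X L (Y t x)"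
    and h: "h \<in> borel_measurable (state_space X)" "\<And>y. y \<in> X \<Longrightarrow> f y \<le> h y \<and> h y \<le> g y"
  shows "integrable P h"
proof (rule Bochner_Integration.integrable_bound)
  show "integrable P (\<lambda>y. \<bar>f y\<bar> + \<bar>g y\<bar>)"
    using envelope_integrable[OF tx f] envelope_integrable[OF tx g] by auto
  show "h \<in> borel_measurable P"
    using h(1) envelope_law(2)[OF tx] by (simp cong: measurable_cong_sets)
  show "AE y in P. norm (h y) \<le> norm (\<bar>f y\<bar> + \<bar>g y\<bar>)"
    using h(2) envelope_law(3)[OF tx] by (intro AE_I2) (fastforce simp: abs_if)
qed

text \<open>
  The upper bound is what makes the risks-to-go of the risk-neutral problem integrable: nothing is
  assumed about them.
\<close>

lemma risk_to_go_neutral_bounds: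
  assumes d: "policy X T d" and "t \<le> T"
  shows "risk_to_go T s c neutral d t \<in> borel_measurable (state_space X) \<and>
    (\<forall>x\<in>X. v t x \<le> risk_to_go T s c neutral d t x \<and>
      risk_to_go T s c neutral d t x \<le> risk_to_go T s c averse d t x)"
  using assms(2)
proof (induction rule: inc_induct)
  case base
  show ?case using wp by (simp add: risk_to_go_horizon value_function_horizon well_posed_def)
next
  case (step t)
  let ?w = "risk_to_go T s c neutral d" and ?W = "risk_to_go T s c averse d"
  have w: "?w (Suc t) \<in> borel_measurable (state_space X)"
    and bounds: "\<And>y. y \<in> X \<Longrightarrow> v (Suc t) y \<le> ?w (Suc t) y \<and> ?w (Suc t) y \<le> ?W (Suc t) y"
    using step by auto
  note [measurable] = w
  have [measurable]: "d t \<in> state_space X \<rightarrow>\<^sub>M count_space UNIV"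
    using d step by (auto simp: policy_def)
  have [measurable]: "s t \<in> borel_measurable (state_space X)" "c t \<in> borel_measurable (state_space X)"
    using wp step by (auto simp: well_posed_def)
  \<comment> \<open>The kernel property of \<open>Qm\<close> makes the integral of the next
    risk-to-go a measurable function of the current state.\<close>
  have [measurable]: "Qm t \<in> state_space X \<rightarrow>\<^sub>M subprob_algebra (state_space X)"
    using kernel_Qm[OF step(2)] by (simp add: kernel_def measurable_prob_algebraD)
  have "?w t = (\<lambda>x. if d t x = Stop then s t x else c t x + (\<integral>y. ?w (Suc t) y \<partial>Qm t x))"
    using step(2) by (simp add: fun_eq_iff risk_to_go_step one_step_expectation_def)
  moreover have "(\<lambda>x. if d t x = Stop then s t x else c t x + (\<integral>y. ?w (Suc t) y \<partial>Qm t x))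
      \<in> borel_measurable (state_space X)"
    by measurable
  moreover have "v t x \<le> ?w t x \<and> ?w t x \<le> ?W t x" if x: "x \<in> X" for x
  proof -
    note tx = step(2) x and Qm = Qm_in_envelope[OF step(2) x]
    note adm = v_admissible[OF tx] risk_to_go_admissible[OF d tx]
    have int: "integrable (Qm t x) (?w (Suc t))"
      by (rule integrable_between[OF tx Qm adm w bounds])
    \<comment> \<open>The lower bound combines this monotonicity with \<open>averse_v\<close>. The
      upper bound uses in addition that \<open>Qm t x\<close> lies in the envelope, so that its
      integral is below the supremum.\<close>
    have "neutral t x (v (Suc t)) \<le> neutral t x (?w (Suc t))"
      using bounds by (intro neutral_mono[OF tx] envelope_integrable[OF tx Qm adm(1)] int) auto
    moreover have "neutral t x (?w (Suc t)) \<le> neutral t x (?W (Suc t))"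
      using bounds by (intro neutral_mono[OF tx] envelope_integrable[OF tx Qm adm(2)] int) auto
    moreover have "neutral t x (?W (Suc t)) \<le> averse t x (?W (Suc t))"
      unfolding one_step_expectation_def by (rule integral_le_averse[OF tx Qm adm(2)])
    ultimately show ?thesis
      using step(2) averse_v[OF tx] by (auto simp: risk_to_go_step value_function_step)
  qed
  ultimately show ?case by simp
qed

lemmas risk_to_go_neutral_measurable = risk_to_go_neutral_bounds[THEN conjunct1]
lemmas v_le_neutral = risk_to_go_neutral_bounds[THEN conjunct2, rule_format, THEN conjunct1]
lemmas neutral_le_averse = risk_to_go_neutral_bounds[THEN conjunct2, rule_format, THEN conjunct2]

lemma v_le_averse:
  "policy X T d \<Longrightarrow> t \<le> T \<Longrightarrow> x \<in> X \<Longrightarrow> v t x \<le> risk_to_go T s c averse d t x"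
  using v_le_neutral neutral_le_averse order_trans by blast

text \<open>The risk-neutral cost of the greedy policy is squeezed between \<open>v\<close> and the
  risk-averse cost of the same policy, which is \<open>v\<close>.\<close>

lemma neutral_greedy:
  "t \<le> T \<Longrightarrow> x \<in> X \<Longrightarrow> risk_to_go T s c neutral (greedy T s c averse) t x = v t x"
  using v_le_neutral[OF greedy_policy, of t x] neutral_le_averse[OF greedy_policy, of t x]
  by (simp add: v_greedy)

section \<open>Optimality criteria and comparison of optimal policies\<close>

text \<open>The lower bound \<open>v\<close> is attained by the greedy policy at every stage and in
  every state, so being minimal means attaining \<open>v\<close>.\<close>

lemma averse_minimal_iff:
  assumes "policy X T d" "t \<le> T" "x \<in> X"
  shows "(\<forall>d'. policy X T d' \<longrightarrow> risk_to_go T s c averse d t x \<le> risk_to_go T s c averse d' t x)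
    \<longleftrightarrow> risk_to_go T s c averse d t x = v t x"
  using assms v_le_averse greedy_policy v_greedy by (metis antisym)

lemma neutral_minimal_iff:
  assumes "policy X T d" "t \<le> T" "x \<in> X"
  shows "(\<forall>d'. policy X T d' \<longrightarrow> risk_to_go T s c neutral d t x \<le> risk_to_go T s c neutral d' t x)
    \<longleftrightarrow> risk_to_go T s c neutral d t x = v t x"
  using assms v_le_neutral greedy_policy neutral_greedy by (metis antisym)

lemma averse_minimal_imp_neutral:
  assumes "policy X T d" "t \<le> T" "x \<in> X" "risk_to_go T s c averse d t x = v t x"
  shows "risk_to_go T s c neutral d t x = v t x"
  using v_le_neutral[OF assms(1-3)] neutral_le_averse[OF assms(1-3)] assms(4) by simp

text \<open>The backward step shared by both converse arguments. When the policy continues, almost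
  sure equality at the next stage bounds the risk of \<open>W\<close> by that of \<open>v\<close>,
  which is the expectation of \<open>v\<close> under \<open>Qm t x\<close> and hence at most that of
  \<open>w\<close>; so \<open>W \<le> w\<close> holds at the current state, where \<open>w\<close>
  equals \<open>v\<close>.\<close>

lemma continuation_eq:
  assumes d: "policy X T d" and tx: "t < T" "x \<in> X" and w: "risk_to_go T s c neutral d t x = v t x"
    and W: "\<And>P. P \<in> A t (Q t x) \<Longrightarrow> AE y in P. risk_to_go T s c averse d (Suc t) y = v (Suc t) y"
  shows "risk_to_go T s c averse d t x = v t x"
proof (cases "d t x = Stop")
  case True
  then show ?thesis using w tx by (simp add: risk_to_go_step)
next
  case False
  let ?w = "risk_to_go T s c neutral d" and ?W = "risk_to_go T s c averse d"
  have "averse t x (?W (Suc t)) \<le> averse t x (v (Suc t))"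
  proof (rule averse_mono_AE[OF tx risk_to_go_admissible[OF d tx] v_admissible[OF tx]])
    fix P assume "P \<in> A t (Q t x)"
    from W[OF this] show "AE y in P. ?W (Suc t) y \<le> v (Suc t) y" by eventually_elim simp
  qed
  also have "\<dots> = neutral t x (v (Suc t))" by (rule averse_v[OF tx])
  also have "\<dots> \<le> neutral t x (?w (Suc t))"
  proof (rule neutral_mono[OF tx])
    show "integrable (Qm t x) (v (Suc t))"
      by (intro envelope_integrable[OF tx] Qm_in_envelope v_admissible tx)
    show "integrable (Qm t x) (?w (Suc t))"
      using tx d v_le_neutral[OF d, of "Suc t"] neutral_le_averse[OF d, of "Suc t"]
      by (intro integrable_between[OF tx Qm_in_envelope[OF tx] v_admissible[OF tx]
            risk_to_go_admissible[OF d tx]] risk_to_go_neutral_measurable) auto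
  qed (use v_le_neutral[OF d, of "Suc t"] tx in auto)
  finally have "?W t x \<le> ?w t x" using False tx by (simp add: risk_to_go_step)
  then show ?thesis using w neutral_le_averse[OF d, of t x] tx by simp
qed

text \<open>Stagewise optimality provides equality with \<open>v\<close> in all states, so the
  induction hypothesis holds on all of \<open>X\<close> and in particular almost surely under every
  law of the envelope.\<close>

lemma neutral_stagewise_imp_averse:
  assumes d: "policy X T d" and w: "\<And>t x. t < T \<Longrightarrow> x \<in> X \<Longrightarrow> risk_to_go T s c neutral d t x = v t x"
    and "t \<le> T" "x \<in> X"
  shows "risk_to_go T s c averse d t x = v t x"
  using assms(3,4)
proof (induction arbitrary: x rule: inc_induct)
  case base
  then show ?case by (simp add: risk_to_go_horizon value_function_horizon)
next
  case (step t)
  show ?case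
  proof (rule continuation_eq[OF d step(2) step.prems w[OF step(2) step.prems]])
    fix P assume "P \<in> A t (Q t x)"
    then show "AE y in P. risk_to_go T s c averse d (Suc t) y = v (Suc t) y"
      using envelope_law(3)[OF step(2) step.prems] step.IH by (intro AE_I2) auto
  qed
qed

text \<open>
  Optimality in \<open>x\<close> forces optimality of the next stage only almost surely under \<open>Qm\<close>; absolute
  continuity transports this to all laws in the envelope.
\<close>

lemma neutral_minimal_imp_averse:
  assumes ac: "\<And>t x P. t < T \<Longrightarrow> x \<in> X \<Longrightarrow> P \<in> A t (Q t x) \<Longrightarrow> absolutely_continuous (Qm t x) P"
    and d: "policy X T d" and "t \<le> T" "x \<in> X" "risk_to_go T s c neutral d t x = v t x"
  shows "risk_to_go T s c averse d t x = v t x"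
  using assms(3-)
proof (induction arbitrary: x rule: inc_induct)
  case base
  then show ?case by (simp add: risk_to_go_horizon value_function_horizon)
next
  case (step t)
  note tx = step(2) step.prems(1)
  let ?w = "risk_to_go T s c neutral d" and ?W = "risk_to_go T s c averse d"
  show ?case
  proof (cases "d t x = Stop")
    case True
    then show ?thesis using step.prems tx by (simp add: risk_to_go_step)
  next
    case False
    note Qm = Qm_in_envelope[OF tx]
    have le: "v (Suc t) y \<le> ?w (Suc t) y" "?w (Suc t) y \<le> ?W (Suc t) y" if "y \<in> X" for y
      using v_le_neutral[OF d _ that] neutral_le_averse[OF d _ that] tx by auto
    have v_int: "integrable (Qm t x) (v (Suc t))"
      by (rule envelope_integrable[OF tx Qm v_admissible[OF tx]])
    have w_int: "integrable (Qm t x) (?w (Suc t))"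
      using tx le
      by (intro integrable_between[OF tx Qm v_admissible[OF tx]
            risk_to_go_admissible[OF d tx]] risk_to_go_neutral_measurable[OF d]) auto
    \<comment> \<open>The policy continues at cost \<open>v t x\<close>, which is at most the
      optimal continuation value. Cancelling \<open>c t x\<close> leaves the inequality between the
      expectations.\<close>
    have "neutral t x (?w (Suc t)) \<le> neutral t x (v (Suc t))"
      using step.prems(2) False tx averse_v[OF tx] by (simp add: risk_to_go_step value_function_step)
    moreover have "neutral t x (v (Suc t)) \<le> neutral t x (?w (Suc t))"
      using le by (intro neutral_mono[OF tx] v_int w_int) auto
    \<comment> \<open>A nonnegative difference with integral zero vanishes almost surely, so the
      policy is optimal in almost every next state under \<open>Qm t x\<close>.\<close>
    ultimately have "(\<integral>y. ?w (Suc t) y - v (Suc t) y \<partial>Qm t x) = 0"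
      using v_int w_int by (simp add: one_step_expectation_def)
    moreover have "AE y in Qm t x. 0 \<le> ?w (Suc t) y - v (Suc t) y"
      using le(1) Qm_law(2)[OF tx] by (intro AE_I2) auto
    ultimately have ae: "AE y in Qm t x. ?w (Suc t) y - v (Suc t) y = 0"
      using v_int w_int by (subst (asm) integral_nonneg_eq_0_iff_AE) auto
    show ?thesis
    proof (rule continuation_eq[OF d tx step.prems(2)])
      fix P assume P: "P \<in> A t (Q t x)"
      have "AE y in P. ?w (Suc t) y - v (Suc t) y = 0"
        by (rule absolutely_continuous_AE[OF _ ac[OF tx P] ae])
          (simp add: envelope_law(2)[OF tx P] Qm_law(1)[OF tx])
      moreover have "AE y in P. y \<in> X" using envelope_law(3)[OF tx P] by (auto intro!: AE_I2)
      \<comment> \<open>The induction hypothesis is a statement about single states and is applied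
        exactly in those where \<open>w\<close> and \<open>v\<close> agree.\<close>
      ultimately show "AE y in P. ?W (Suc t) y = v (Suc t) y"
        by eventually_elim (simp add: step.IH)
    qed
  qed
qed

lemma stagewise_optimal_iff:
  "stagewise_optimal_policy X T s c averse d \<longleftrightarrow> stagewise_optimal_policy X T s c neutral d"
proof (cases "policy X T d")
  case d: True
  \<comment> \<open>From left to right the argument works separately in each state; the reverse
    direction needs equality at all later stages as well.\<close>
  have "(\<forall>t<T. \<forall>x\<in>X. risk_to_go T s c averse d t x = v t x)
      \<longleftrightarrow> (\<forall>t<T. \<forall>x\<in>X. risk_to_go T s c neutral d t x = v t x)"
    using averse_minimal_imp_neutral[OF d] neutral_stagewise_imp_averse[OF d] by auto
  then show ?thesis
    using averse_minimal_iff[OF d] neutral_minimal_iff[OF d] d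
    by (simp add: stagewise_optimal_policy_def)
qed (simp add: stagewise_optimal_policy_def)

lemma optimal_averse_iff:
  "optimal_policy X T s c averse d \<longleftrightarrow>
    policy X T d \<and> (\<forall>x\<in>X. risk_to_go T s c averse d 0 x = v 0 x)"
  using averse_minimal_iff[of d 0] by (auto simp: optimal_policy_def)

lemma optimal_neutral_iff:
  "optimal_policy X T s c neutral d \<longleftrightarrow>
    policy X T d \<and> (\<forall>x\<in>X. risk_to_go T s c neutral d 0 x = v 0 x)"
  using neutral_minimal_iff[of d 0] by (auto simp: optimal_policy_def)

lemma optimal_averse_imp_neutral:
  "optimal_policy X T s c averse d \<Longrightarrow> optimal_policy X T s c neutral d"
  using averse_minimal_imp_neutral[of d 0] by (auto simp: optimal_averse_iff optimal_neutral_iff)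

lemma optimal_iff:
  assumes "\<And>t x P. t < T \<Longrightarrow> x \<in> X \<Longrightarrow> P \<in> A t (Q t x) \<Longrightarrow> absolutely_continuous (Qm t x) P"
  shows "optimal_policy X T s c averse d \<longleftrightarrow> optimal_policy X T s c neutral d"
  using optimal_averse_imp_neutral neutral_minimal_imp_averse[OF assms, of d 0]
  by (auto simp: optimal_averse_iff optimal_neutral_iff)

end

theorem proposition1:
  fixes X :: "(real ^ 'n) set"
    and T :: nat
    and M :: "'w measure"
    and F :: "nat \<Rightarrow> 'w measure"
    and L :: "('w \<Rightarrow> real) set"
    and Q Qm :: "nat \<Rightarrow> real ^ 'n \<Rightarrow> (real ^ 'n) measure"
    and Y :: "nat \<Rightarrow> real ^ 'n \<Rightarrow> 'w \<Rightarrow> real ^ 'n"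
    and \<rho> :: "nat \<Rightarrow> ('w \<Rightarrow> real) \<Rightarrow> 'w \<Rightarrow> real"
    and A :: "nat \<Rightarrow> (real ^ 'n) measure \<Rightarrow> (real ^ 'n) measure set"
    and s c :: "nat \<Rightarrow> real ^ 'n \<Rightarrow> real"
  defines "averse \<equiv> one_step_risk M \<rho> Y"
    and "neutral \<equiv> one_step_expectation Qm"
  assumes "prob_space M"
    and "filtration (space M) F"
    and "\<And>t. subalgebra M (F t)"
    and rich: "\<And>t. t < T \<Longrightarrow> \<exists>U. fresh_variable M F t borel U (uniform_measure lborel {0..1::real})"
    and "risk_space M L"
    and "\<And>t. t < T \<Longrightarrow> kernel X (Q t)"
    and "\<And>t x. t < T \<Longrightarrow> x \<in> X \<Longrightarrow> fresh_variable M F t (state_space X) (Y t x) (Q t x)"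
    and "\<And>t. t < T \<Longrightarrow> coherent_risk_measure M F L t (\<rho> t)"
    and "\<And>t x. t < T \<Longrightarrow> x \<in> X \<Longrightarrow> risk_envelope M X L (\<rho> t) (Y t x) (A t (Q t x))"
    and "well_posed X T L Y s c averse"
    and "\<And>t. t < T \<Longrightarrow> distribution_invariant M F L t (\<rho> t)"
    and "\<And>t. t < T \<Longrightarrow> stoch_increasing X (Q t)"
    and "\<And>t. t < T \<Longrightarrow> antimono_on X (c t)"
    and "\<And>t. t \<le> T \<Longrightarrow> antimono_on X (s t)"
    and "\<And>t x. t < T \<Longrightarrow> x \<in> X \<Longrightarrow> stoch_least X (A t (Q t x)) (Qm t x)"
    and "\<And>t. t < T \<Longrightarrow> kernel X (Qm t)"
  shows "(\<forall>t\<le>T. \<forall>x\<in>X. value_function T s c averse t x = value_function T s c neutral t x) \<and>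
    (\<forall>d. stagewise_optimal_policy X T s c averse d \<longleftrightarrow>
         stagewise_optimal_policy X T s c neutral d) \<and>
    (\<forall>d. optimal_policy X T s c averse d \<longrightarrow> optimal_policy X T s c neutral d) \<and>
    ((\<forall>t<T. \<forall>x\<in>X. \<forall>P\<in>A t (Q t x). absolutely_continuous (Qm t x) P) \<longrightarrow>
     (\<forall>d. optimal_policy X T s c averse d \<longleftrightarrow> optimal_policy X T s c neutral d))"
proof -
  interpret monotone_stopping M X T F L Q Qm Y \<rho> A s c
    using assms(3-) unfolding averse_def monotone_stopping_def monotone_stopping_axioms_def by simp
  show ?thesis
    using value_function_neutral stagewise_optimal_iff optimal_averse_imp_neutral optimal_iff
    unfolding averse_def neutral_def by simp
qed

end
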